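(* Let $B$ be a matrix, and let $D$ denote a nonnegative, diagonal matrix with $\operatorname{trace}(D^2) = 1$. The factorization $B = TD$ satisfies $\|T\| \leq \alpha$ if and only if $D$ satisfies $$\lambda_{\max}(B^* B - \alpha^2 D^2) \leq 0.$$ In particular, if no $D$ verifies this bound, then no factorization $B = TD$ admits $\|T\| \leq \alpha$.
   Context: Matrices are real or complex, and $\alpha$ is a real scalar. Throughout, the letter $D$ is reserved for nonnegative, diagonal matrices with $\operatorname{trace}(D^2)=1$ (of size equal to the number of columns of $B$). $\|\cdot\|$ is the spectral norm, $B^*$ is the conjugate transpose of $B$, and $\lambda_{\max}$ denotes the algebraically maximal eigenvalue of a Hermitian matrix.
   Formalization: The equivalence is stated for α ≥ 0, since it fails for α < 0 (B = 0, α = −1); for singular D it reads "some T with B = TD has ‖T‖ ≤ α", as T is then not determined by B and D. *)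

theory Defs
  imports "HOL-Analysis.Analysis"
begin

(* The norm of 'a ^ 'n is the Euclidean norm (for complex entries, the Hermitian one), so the
   operator norm of the induced map is the spectral norm. *)
definition spectral_norm :: "'a::real_normed_field ^ 'n ^ 'm \<Rightarrow> real" where
  "spectral_norm A = onorm (\<lambda>x. A *v x)"

(* Over the reals the conjugate transpose is the library's transpose. *)
definition conj_transpose :: "complex ^ 'n ^ 'm \<Rightarrow> complex ^ 'm ^ 'n" where
  "conj_transpose A = map_matrix cnj (transpose A)"

(* Meant for Hermitian (or real symmetric) matrices: all their eigenvalues are real, and the
   set of eigenvalues is finite and nonempty, so that Max is the greatest one. *)
definition lambda_max :: "'a::real_normed_field ^ 'n ^ 'n \<Rightarrow> real" where
  "lambda_max A = Max {r::real. \<exists>v. v \<noteq> 0 \<and> A *v v = r *\<^sub>R v}"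

(* Over the complex numbers, membership in \<real>\<^sub>\<ge>\<^sub>0 says that the entry is real and nonnegative. *)
definition normalized_nonneg_diagonal :: "'a::real_normed_field ^ 'n ^ 'n \<Rightarrow> bool" where
  "normalized_nonneg_diagonal D \<longleftrightarrow>
     (\<forall>i j. i \<noteq> j \<longrightarrow> D $ i $ j = 0) \<and>
     (\<forall>i. D $ i $ i \<in> \<real>\<^sub>\<ge>\<^sub>0) \<and>
     trace (D ** D) = 1"

end

theory Submission
  imports Defs
begin

text \<open>
  For \<open>0 \<le> \<alpha>\<close>, both sides of the equivalence say that \<open>norm (B x) \<le> \<alpha> * norm (D x)\<close> for every vector \<open>x\<close>.

  For the eigenvalue condition this holds because
  \<open>\<langle>(B\<^sup>* B - \<alpha>\<^sup>2 D\<^sup>2) x, x\<rangle> = norm (B x)\<^sup>2 - \<alpha>\<^sup>2 norm (D x)\<^sup>2\<close> and because the largest eigenvalue of a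
  self-adjoint map is the maximum of its quadratic form on the unit sphere
  (\<open>lambda_max_nonpos_iff\<close>).

  For the factorization, \<open>B = T D\<close> with \<open>norm T \<le> \<alpha>\<close> clearly gives the pointwise bound. Conversely,
  the pointwise bound forces \<open>B\<close> to vanish on the kernel of \<open>D\<close>, so \<open>T = B D\<^sup>+\<close>, with \<open>D\<^sup>+\<close> the
  pseudo-inverse of the diagonal matrix \<open>D\<close>, satisfies \<open>T D = B\<close>, and
  \<open>norm (T y) \<le> \<alpha> * norm (D D\<^sup>+ y) \<le> \<alpha> * norm y\<close> (\<open>exists_bounded_factor\<close>). When \<open>D\<close> is invertible,
  every \<open>y\<close> has the form \<open>D x\<close>, so the pointwise bound is exactly the norm bound for the only
  possible \<open>T\<close>.

  The real and the complex case are treated at once. On \<open>\<complex>\<^sup>n\<close> the real inner product is the real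
  part of the Hermitian one, so a Hermitian matrix acts as a self-adjoint real-linear map, and only
  real eigenvalues occur in the definition of \<open>lambda_max\<close>. Hence the spectral theory of self-adjoint
  maps on a real Euclidean space serves for both fields.
\<close>

section \<open>The largest eigenvalue of a self-adjoint map\<close>

text \<open>
  If \<open>\<langle>g v, v\<rangle> = 0\<close>, then \<open>v\<close> minimizes the nonnegative quadratic form of \<open>g\<close>, so its derivative
  \<open>2 \<langle>g v, w\<rangle>\<close> in any direction \<open>w\<close> must vanish; the direction \<open>w = g v\<close> is enough.
\<close>

lemma psd_self_adjoint_isotropic_imp_kernel:
  fixes g :: "'v::real_inner \<Rightarrow> 'v"
  assumes lin: "linear g"
    and self_adjoint: "\<And>x y. g x \<bullet> y = x \<bullet> g y"
    and psd: "\<And>x. 0 \<le> g x \<bullet> x"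
    and isotropic: "g v \<bullet> v = 0"
  shows "g v = 0"
proof -
  define w where "w = g v"
  define p where "p = w \<bullet> w"
  define c where "c = g w \<bullet> w"
  have "c \<ge> 0" unfolding c_def by (rule psd)
  have expand: "g (v + t *\<^sub>R w) \<bullet> (v + t *\<^sub>R w) = 2 * t * p + t\<^sup>2 * c" for t
  proof -
    have "g w \<bullet> v = p" by (simp add: self_adjoint p_def w_def)
    moreover have "g v \<bullet> w = p" by (simp add: p_def w_def)
    ultimately show ?thesis
      using isotropic
      by (simp add: linear_add[OF lin] linear_scale[OF lin] inner_add_left inner_add_right
          c_def power2_eq_square algebra_simps)
  qed
  \<comment> \<open>The minimizer \<open>t = - p / c\<close> of the expanded form, with \<open>c + 1\<close> in place of \<open>c\<close>, which may be 0.\<close>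
  define t where "t = - p / (c + 1)"
  have p: "p = - (t * (c + 1))"
    using \<open>c \<ge> 0\<close> by (simp add: t_def)
  have "0 \<le> 2 * t * p + t\<^sup>2 * c"
    using psd[of "v + t *\<^sub>R w"] expand[of t] by simp
  also have "\<dots> = - (t\<^sup>2 * (c + 2))"
    unfolding p by (simp add: power2_eq_square algebra_simps)
  finally have "t = 0"
    using \<open>c \<ge> 0\<close> by (simp add: mult_le_0_iff)
  then have "p = 0" by (simp add: p)
  then show ?thesis by (simp add: p_def w_def)
qed

text \<open>
  The quadratic form attains its maximum \<open>r\<close> on the unit sphere, which is compact. Then \<open>r I - f\<close> is
  positive semidefinite and isotropic at the maximizer, which is therefore an eigenvector.
\<close>

lemma self_adjoint_attains_max_eigenvalue:
  fixes f :: "'v::euclidean_space \<Rightarrow> 'v"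
  assumes lin: "linear f"
    and self_adjoint: "\<And>x y. f x \<bullet> y = x \<bullet> f y"
  obtains r v where "v \<noteq> 0" "f v = r *\<^sub>R v" "\<And>x. f x \<bullet> x \<le> r * (x \<bullet> x)"
proof -
  have cont: "continuous_on (sphere 0 1) (\<lambda>x. f x \<bullet> x)"
    by (intro continuous_intros linear_continuous_on linear_conv_bounded_linear[THEN iffD1] lin)
  have "sphere (0::'v) 1 \<noteq> {}" by simp
  then obtain v where v: "v \<in> sphere 0 1"
    and max: "\<And>y. y \<in> sphere 0 1 \<Longrightarrow> f y \<bullet> y \<le> f v \<bullet> v"
    using continuous_attains_sup[OF compact_sphere _ cont] by blast
  define r where "r = f v \<bullet> v"
  have vv: "v \<bullet> v = 1" using v by (simp add: dot_square_norm)
  have bound: "f x \<bullet> x \<le> r * (x \<bullet> x)" for x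
  proof (cases "x = 0")
    case True
    then show ?thesis by (simp add: linear_0[OF lin])
  next
    case False
    define u where "u = x /\<^sub>R norm x"
    have "u \<in> sphere 0 1" using False by (simp add: u_def)
    then have "f u \<bullet> u \<le> r" using max r_def by blast
    moreover have "x = norm x *\<^sub>R u" using False by (simp add: u_def)
    then have "f x \<bullet> x = (f u \<bullet> u) * (norm x)\<^sup>2"
      by (metis linear_scale[OF lin] inner_scaleR_left inner_scaleR_right
          mult.commute mult.left_commute power2_eq_square)
    ultimately show ?thesis
      by (simp add: dot_square_norm mult_right_mono)
  qed
  have "r *\<^sub>R v - f v = 0"
  proof (rule psd_self_adjoint_isotropic_imp_kernel[where g = "\<lambda>x. r *\<^sub>R x - f x"])
    show "linear (\<lambda>x. r *\<^sub>R x - f x)"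
      by (intro linear_compose_sub lin linear_scaleR)
  qed (use bound vv in \<open>auto simp: inner_diff_left inner_diff_right self_adjoint r_def\<close>)
  moreover have "v \<noteq> 0" using vv by auto
  ultimately show ?thesis using that bound by (metis eq_iff_diff_eq_0)
qed

text \<open>
  Eigenvectors for distinct eigenvalues are orthogonal, and a Euclidean space has room for only
  finitely many mutually orthogonal nonzero vectors.
\<close>

lemma finite_eigenvalues_self_adjoint:
  fixes f :: "'v::euclidean_space \<Rightarrow> 'v"
  assumes self_adjoint: "\<And>x y. f x \<bullet> y = x \<bullet> f y"
  shows "finite {r::real. \<exists>v. v \<noteq> 0 \<and> f v = r *\<^sub>R v}" (is "finite ?E")
proof -
  obtain e where e: "\<And>r. r \<in> ?E \<Longrightarrow> e r \<noteq> 0 \<and> f (e r) = r *\<^sub>R e r"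
    using bchoice[of ?E "\<lambda>r v. v \<noteq> 0 \<and> f v = r *\<^sub>R v"] by auto
  have orth: "e r \<bullet> e s = 0" if "r \<in> ?E" "s \<in> ?E" "r \<noteq> s" for r s
  proof -
    have "r * (e r \<bullet> e s) = s * (e r \<bullet> e s)"
      using self_adjoint[of "e r" "e s"] e[OF that(1)] e[OF that(2)] by simp
    with that(3) show ?thesis by simp
  qed
  have "inj_on e ?E"
  proof (rule inj_onI, rule ccontr)
    fix r s
    assume rs: "r \<in> ?E" "s \<in> ?E" "e r = e s" "r \<noteq> s"
    then have "e r \<bullet> e r = 0" using orth[OF rs(1,2,4)] by simp
    then show False using e[OF rs(1)] by simp
  qed
  moreover have "finite (e ` ?E)"
    by (rule pairwise_orthogonal_imp_finite)
      (use orth in \<open>auto simp: pairwise_def orthogonal_def\<close>)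
  ultimately show ?thesis by (rule finite_imageD[rotated])
qed

lemma lambda_max_nonpos_iff:
  fixes A :: "'a::{real_normed_field, euclidean_space} ^ 'n ^ 'n"
  assumes self_adjoint: "\<And>x y. (A *v x) \<bullet> y = x \<bullet> (A *v y)"
  shows "lambda_max A \<le> 0 \<longleftrightarrow> (\<forall>x. (A *v x) \<bullet> x \<le> 0)"
proof -
  define E where "E = {r::real. \<exists>v. v \<noteq> 0 \<and> A *v v = r *\<^sub>R v}"
  have fin: "finite E"
    unfolding E_def using self_adjoint by (rule finite_eigenvalues_self_adjoint)
  have lin: "linear (\<lambda>x. A *v x)"
    by (simp add: bounded_linear.linear matrix_vector_mul_bounded_linear)
  obtain r v where "v \<noteq> 0" "A *v v = r *\<^sub>R v"
    and bound: "\<And>x. (A *v x) \<bullet> x \<le> r * (x \<bullet> x)"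
    by (rule self_adjoint_attains_max_eigenvalue[OF lin self_adjoint]) (rule that)
  then have r: "r \<in> E" by (auto simp: E_def)
  show ?thesis
  proof
    assume "lambda_max A \<le> 0"
    then have "r \<le> 0"
      using Max_ge[OF fin r] by (simp add: lambda_max_def E_def)
    then show "\<forall>x. (A *v x) \<bullet> x \<le> 0"
      using bound by (meson inner_ge_zero mult_nonpos_nonneg order_trans)
  next
    assume nonpos: "\<forall>x. (A *v x) \<bullet> x \<le> 0"
    have "s \<le> 0" if s: "s \<in> E" for s
    proof -
      obtain u where u: "u \<noteq> 0" "A *v u = s *\<^sub>R u" using s by (auto simp: E_def)
      then have "s * (u \<bullet> u) \<le> 0" using nonpos by (metis inner_scaleR_left)
      moreover have "u \<bullet> u > 0" using u by simp
      ultimately show ?thesis by (simp add: mult_le_0_iff)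
    qed
    then have "Max E \<le> 0"
      using fin r by (intro Max.boundedI) auto
    then show "lambda_max A \<le> 0" by (simp add: lambda_max_def E_def)
  qed
qed

section \<open>Spectral norm and nonnegative diagonal matrices\<close>

lemma spectral_norm_le_iff:
  fixes T :: "'a::{real_normed_field, euclidean_space} ^ 'n ^ 'm"
  shows "spectral_norm T \<le> \<alpha> \<longleftrightarrow> (\<forall>x. norm (T *v x) \<le> \<alpha> * norm x)"
proof
  assume "spectral_norm T \<le> \<alpha>"
  then show "\<forall>x. norm (T *v x) \<le> \<alpha> * norm x"
    unfolding spectral_norm_def
    by (meson matrix_vector_mul_bounded_linear mult_right_mono norm_ge_zero onorm order_trans)
qed (simp add: spectral_norm_def onorm_le)

lemma scaleR_matrix_vector_mult:
  fixes A :: "'a::real_algebra_1 ^ 'n ^ 'm"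
  shows "(c *\<^sub>R A) *v x = c *\<^sub>R (A *v x)"
  by (simp add: matrix_vector_mult_def vec_eq_iff scaleR_sum_right)

lemma normalized_nonneg_diagonal_action:
  fixes D :: "'a::{real_normed_field, euclidean_space} ^ 'n ^ 'n"
  assumes "normalized_nonneg_diagonal D"
  obtains d :: "'n \<Rightarrow> real" where "\<And>x i. (D *v x) $ i = d i *\<^sub>R x $ i"
proof -
  have off: "D $ i $ j = 0" if "i \<noteq> j" for i j
    using assms that by (auto simp: normalized_nonneg_diagonal_def)
  have "\<forall>i. \<exists>r. D $ i $ i = of_real r"
    using assms by (auto simp: normalized_nonneg_diagonal_def nonneg_Reals_def)
  then obtain d where d: "\<And>i. D $ i $ i = of_real (d i)" by metis
  have "(D *v x) $ i = d i *\<^sub>R x $ i" for x i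
  proof -
    have "(D *v x) $ i = (\<Sum>j\<in>UNIV. if j = i then D $ i $ i * x $ i else 0)"
      unfolding matrix_vector_mult_def vec_lambda_beta by (rule sum.cong) (auto simp: off)
    then show ?thesis by (simp add: d scaleR_conv_of_real)
  qed
  then show ?thesis by (rule that)
qed

lemma normalized_nonneg_diagonal_self_adjoint:
  fixes D :: "'a::{real_normed_field, euclidean_space} ^ 'n ^ 'n"
  assumes "normalized_nonneg_diagonal D"
  shows "(D *v x) \<bullet> y = x \<bullet> (D *v y)"
proof -
  obtain d where d: "\<And>x i. (D *v x) $ i = d i *\<^sub>R x $ i"
    using normalized_nonneg_diagonal_action[OF assms] by blast
  show ?thesis by (simp add: inner_vec_def d)
qed

section \<open>The pointwise domination \<open>norm (B x) \<le> \<alpha> * norm (D x)\<close>\<close>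

lemma lambda_max_nonpos_iff_dominated:
  fixes B :: "'a::{real_normed_field, euclidean_space} ^ 'n ^ 'm"
  assumes adj: "\<And>x y. (B' *v x) \<bullet> y = x \<bullet> (B *v y)"
    and D: "normalized_nonneg_diagonal D"
    and "0 \<le> \<alpha>"
  shows "lambda_max (B' ** B - \<alpha>\<^sup>2 *\<^sub>R (D ** D)) \<le> 0
    \<longleftrightarrow> (\<forall>x. norm (B *v x) \<le> \<alpha> * norm (D *v x))"
proof -
  let ?A = "B' ** B - \<alpha>\<^sup>2 *\<^sub>R (D ** D)"
  note D_adj = normalized_nonneg_diagonal_self_adjoint[OF D]
  have form: "(?A *v x) \<bullet> y = (B *v x) \<bullet> (B *v y) - \<alpha>\<^sup>2 * ((D *v x) \<bullet> (D *v y))" for x y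
    by (simp add: matrix_vector_mult_diff_rdistrib scaleR_matrix_vector_mult inner_diff_left
        matrix_vector_mul_assoc[symmetric] adj D_adj)
  have "lambda_max ?A \<le> 0 \<longleftrightarrow> (\<forall>x. (?A *v x) \<bullet> x \<le> 0)"
    by (rule lambda_max_nonpos_iff) (metis form inner_commute)
  also have "\<dots> \<longleftrightarrow> (\<forall>x. (norm (B *v x))\<^sup>2 \<le> (\<alpha> * norm (D *v x))\<^sup>2)"
    by (simp add: form dot_square_norm power_mult_distrib)
  also have "\<dots> \<longleftrightarrow> (\<forall>x. norm (B *v x) \<le> \<alpha> * norm (D *v x))"
    using \<open>0 \<le> \<alpha>\<close> by simp
  finally show ?thesis .
qed

lemma dominated_of_factor:
  fixes T :: "'a::{real_normed_field, euclidean_space} ^ 'n ^ 'm"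
  assumes "spectral_norm T \<le> \<alpha>"
  shows "norm ((T ** D) *v x) \<le> \<alpha> * norm (D *v x)"
  using assms by (simp add: spectral_norm_le_iff matrix_vector_mul_assoc[symmetric])

text \<open>
  The factor is \<open>B D\<^sup>+\<close>. Since \<open>D (x - D\<^sup>+ D x) = 0\<close>, domination yields \<open>B x = B D\<^sup>+ D x\<close>; and \<open>D D\<^sup>+\<close>
  only erases coordinates, so it does not increase norms.
\<close>

lemma exists_bounded_factor:
  fixes B :: "'a::{real_normed_field, euclidean_space} ^ 'n ^ 'm"
  assumes D: "normalized_nonneg_diagonal D"
    and "0 \<le> \<alpha>"
    and dom: "\<And>x. norm (B *v x) \<le> \<alpha> * norm (D *v x)"
  shows "\<exists>T. B = T ** D \<and> spectral_norm T \<le> \<alpha>"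
proof -
  obtain d where d: "\<And>x i. (D *v x) $ i = d i *\<^sub>R x $ i"
    using normalized_nonneg_diagonal_action[OF D] by blast
  \<comment> \<open>Since \<open>inverse 0 = 0\<close>, this is the pseudo-inverse even where \<open>d\<close> vanishes.\<close>
  define P :: "'a ^ 'n ^ 'n"
    where "P = (\<chi> i j. if i = j then of_real (inverse (d i)) else 0)"
  have P: "(P *v x) $ i = inverse (d i) *\<^sub>R x $ i" for x i
  proof -
    have "(P *v x) $ i = (\<Sum>j\<in>UNIV. if j = i then of_real (inverse (d i)) * x $ i else 0)"
      unfolding matrix_vector_mult_def P_def vec_lambda_beta by (rule sum.cong) auto
    then show ?thesis by (simp add: scaleR_conv_of_real)
  qed
  have "B *v x = ((B ** P) ** D) *v x" for x
  proof -
    have "(D *v (x - P *v (D *v x))) $ i = 0" for i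
      by (cases "d i = 0") (simp_all add: d P)
    then have "D *v (x - P *v (D *v x)) = 0" by (simp add: vec_eq_iff)
    then have "B *v (x - P *v (D *v x)) = 0"
      using dom[of "x - P *v (D *v x)"] by simp
    then show ?thesis
      by (simp add: matrix_vector_mult_diff_distrib matrix_vector_mul_assoc matrix_mul_assoc)
  qed
  then have "B = (B ** P) ** D" by (simp add: matrix_eq)
  moreover have "spectral_norm (B ** P) \<le> \<alpha>"
    unfolding spectral_norm_le_iff
  proof
    fix y
    have "norm ((D *v (P *v y)) $ i) \<le> norm (y $ i)" for i
      by (cases "d i = 0") (simp_all add: d P)
    then have "norm (D *v (P *v y)) \<le> norm y" by (rule norm_le_componentwise_cart)
    then have "\<alpha> * norm (D *v (P *v y)) \<le> \<alpha> * norm y"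
      using \<open>0 \<le> \<alpha>\<close> by (rule mult_left_mono)
    with dom[of "P *v y"] show "norm ((B ** P) *v y) \<le> \<alpha> * norm y"
      by (simp add: matrix_vector_mul_assoc)
  qed
  ultimately show ?thesis by blast
qed

lemma spectral_norm_le_of_dominated_invertible:
  fixes T :: "'a::{real_normed_field, euclidean_space} ^ 'n ^ 'm"
  assumes "invertible D"
    and dom: "\<And>x. norm ((T ** D) *v x) \<le> \<alpha> * norm (D *v x)"
  shows "spectral_norm T \<le> \<alpha>"
proof -
  obtain D' where D': "D ** D' = mat 1" using assms(1) by (auto simp: invertible_def)
  have "norm (T *v y) \<le> \<alpha> * norm y" for y
    using dom[of "D' *v y"]
    by (simp add: matrix_vector_mul_assoc matrix_mul_assoc[symmetric] D')
  then show ?thesis by (simp add: spectral_norm_le_iff)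
qed

section \<open>The factorization criterion\<close>

text \<open>
  The adjoint relation for the real inner product is the only link between \<open>B'\<close> and \<open>B\<close> that the
  argument uses, so the lemma applies to the transpose over \<open>\<real>\<close> and to the conjugate transpose
  over \<open>\<complex>\<close>.
\<close>

lemma factorization_criterion:
  fixes B :: "'a::{real_normed_field, euclidean_space} ^ 'n ^ 'm"
  assumes adj: "\<And>x y. (B' *v x) \<bullet> y = x \<bullet> (B *v y)"
  shows
    "(0 \<le> \<alpha> \<longrightarrow>
         (\<forall>D. normalized_nonneg_diagonal D \<longrightarrow>
            ((\<exists>T. B = T ** D \<and> spectral_norm T \<le> \<alpha>) \<longleftrightarrow>
              lambda_max (B' ** B - \<alpha>\<^sup>2 *\<^sub>R (D ** D)) \<le> 0) \<and>
            (invertible D \<longrightarrow>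
              (\<forall>T. B = T ** D \<longrightarrow>
                (spectral_norm T \<le> \<alpha> \<longleftrightarrow>
                  lambda_max (B' ** B - \<alpha>\<^sup>2 *\<^sub>R (D ** D)) \<le> 0))))) \<and>
       ((\<forall>D. normalized_nonneg_diagonal D \<longrightarrow>
            \<not> lambda_max (B' ** B - \<alpha>\<^sup>2 *\<^sub>R (D ** D)) \<le> 0) \<longrightarrow>
         \<not> (\<exists>T D. normalized_nonneg_diagonal D \<and> B = T ** D \<and> spectral_norm T \<le> \<alpha>))"
    (is "(_ \<longrightarrow> ?criterion) \<and> _")
proof -
  have criterion: ?criterion if "0 \<le> \<alpha>"
  proof (intro allI impI)
    fix D :: "'a ^ 'n ^ 'n"
    assume D: "normalized_nonneg_diagonal D"
    note dominated_iff = lambda_max_nonpos_iff_dominated[OF adj D that]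
    show "((\<exists>T. B = T ** D \<and> spectral_norm T \<le> \<alpha>) \<longleftrightarrow>
        lambda_max (B' ** B - \<alpha>\<^sup>2 *\<^sub>R (D ** D)) \<le> 0) \<and>
      (invertible D \<longrightarrow>
        (\<forall>T. B = T ** D \<longrightarrow>
          (spectral_norm T \<le> \<alpha> \<longleftrightarrow>
            lambda_max (B' ** B - \<alpha>\<^sup>2 *\<^sub>R (D ** D)) \<le> 0)))"
      unfolding dominated_iff
      using dominated_of_factor exists_bounded_factor[OF D that, of B]
        spectral_norm_le_of_dominated_invertible[of D _ \<alpha>]
      by blast
  qed
  \<comment> \<open>A bound on a norm is nonnegative, so the last claim also covers negative \<open>\<alpha>\<close>.\<close>
  moreover have "0 \<le> \<alpha>" if "spectral_norm T \<le> \<alpha>" for T :: "'a ^ 'n ^ 'm"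
    using that onorm_pos_le[OF matrix_vector_mul_bounded_linear, of T]
    by (simp add: spectral_norm_def)
  ultimately show ?thesis by blast
qed

lemma transpose_adjoint:
  fixes B :: "real ^ 'n ^ 'm"
  shows "(transpose B *v x) \<bullet> y = x \<bullet> (B *v y)"
  by (simp only: transpose_matrix_vector dot_lmul_matrix)

text \<open>
  The inner product on \<open>\<complex>\<close> is \<open>Re (cnj a * b)\<close>, so an entry \<open>c\<close> moves across it as \<open>cnj c\<close>.
\<close>

lemma conj_transpose_adjoint:
  fixes C :: "complex ^ 'n ^ 'm"
  shows "(conj_transpose C *v x) \<bullet> y = x \<bullet> (C *v y)"
proof -
  have move: "(cnj c * a) \<bullet> b = a \<bullet> (c * b)" for a b c :: complex
    by (simp add: inner_complex_def algebra_simps)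
  have "(conj_transpose C *v x) \<bullet> y = (\<Sum>j\<in>UNIV. \<Sum>i\<in>UNIV. x $ i \<bullet> (C $ i $ j * y $ j))"
    by (simp add: inner_vec_def matrix_vector_mult_def conj_transpose_def transpose_def
        map_matrix_def inner_sum_left move)
  also have "\<dots> = (\<Sum>i\<in>UNIV. \<Sum>j\<in>UNIV. x $ i \<bullet> (C $ i $ j * y $ j))"
    by (rule sum.swap)
  also have "\<dots> = x \<bullet> (C *v y)"
    by (simp add: inner_vec_def matrix_vector_mult_def inner_sum_right)
  finally show ?thesis .
qed

theorem theorem3p1:
  fixes B :: "real ^ 'n ^ 'm" and C :: "complex ^ 'n ^ 'm" and \<alpha> :: real
  shows
    "((0 \<le> \<alpha> \<longrightarrow>
         (\<forall>D. normalized_nonneg_diagonal D \<longrightarrow>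
            ((\<exists>T. B = T ** D \<and> spectral_norm T \<le> \<alpha>) \<longleftrightarrow>
              lambda_max (transpose B ** B - \<alpha>\<^sup>2 *\<^sub>R (D ** D)) \<le> 0) \<and>
            (invertible D \<longrightarrow>
              (\<forall>T. B = T ** D \<longrightarrow>
                (spectral_norm T \<le> \<alpha> \<longleftrightarrow>
                  lambda_max (transpose B ** B - \<alpha>\<^sup>2 *\<^sub>R (D ** D)) \<le> 0))))) \<and>
       ((\<forall>D. normalized_nonneg_diagonal D \<longrightarrow>
            \<not> lambda_max (transpose B ** B - \<alpha>\<^sup>2 *\<^sub>R (D ** D)) \<le> 0) \<longrightarrow>
         \<not> (\<exists>T D. normalized_nonneg_diagonal D \<and> B = T ** D \<and> spectral_norm T \<le> \<alpha>)))
     \<and>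
     ((0 \<le> \<alpha> \<longrightarrow>
         (\<forall>D. normalized_nonneg_diagonal D \<longrightarrow>
            ((\<exists>T. C = T ** D \<and> spectral_norm T \<le> \<alpha>) \<longleftrightarrow>
              lambda_max (conj_transpose C ** C - \<alpha>\<^sup>2 *\<^sub>R (D ** D)) \<le> 0) \<and>
            (invertible D \<longrightarrow>
              (\<forall>T. C = T ** D \<longrightarrow>
                (spectral_norm T \<le> \<alpha> \<longleftrightarrow>
                  lambda_max (conj_transpose C ** C - \<alpha>\<^sup>2 *\<^sub>R (D ** D)) \<le> 0))))) \<and>
       ((\<forall>D. normalized_nonneg_diagonal D \<longrightarrow>
            \<not> lambda_max (conj_transpose C ** C - \<alpha>\<^sup>2 *\<^sub>R (D ** D)) \<le> 0) \<longrightarrow>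
         \<not> (\<exists>T D. normalized_nonneg_diagonal D \<and> C = T ** D \<and> spectral_norm T \<le> \<alpha>)))"
proof (rule conjI, goal_cases)
  case 1
  show ?case by (rule factorization_criterion, rule transpose_adjoint)
next
  case 2
  show ?case by (rule factorization_criterion, rule conj_transpose_adjoint)
qed

end
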